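(* Let $N=S^2$ (respectively $N=H^2$) and let $\xi\mapsto(\xi,w(\xi))$ be a local holomorphic section of $TN\to N$. The surface in $\mathbb{E}^3$ (respectively $\mathbb{E}^3_1$) determined by this section, parameterized by $\xi$ and given by $$z=\mp\left(\tfrac12\xi^2\partial\partial w-\xi\,\partial w+w\right)+\tfrac12\bar\partial\bar\partial\bar w,$$ $$t=\mp\left(\tfrac12\xi\,\partial\partial w-\tfrac12\partial w+\tfrac12\bar\xi\,\bar\partial\bar\partial\bar w-\tfrac12\bar\partial\bar w\right),$$ is minimal (respectively maximal). Here the upper sign is the Euclidean case and the lower sign is the Lorentzian case.
   Context: $\mathbb{E}^3$ is $\mathbb{R}^3$ with its Euclidean metric and $\mathbb{E}^3_1$ is $\mathbb{R}^3$ with the flat metric $(dx^1)^2+(dx^2)^2-(dx^3)^2$; $z=x^1+ix^2$, $t=x^3$. $\xi$ is the complex coordinate on $S^2$ (resp. $H^2$, $|\xi|<1$) in which the metric of curvature $1$ (resp. $-1$) is $4(1\pm\xi\bar\xi)^{-2}d\xi d\bar\xi$; $(\xi,\eta)$ denotes the tangent vector $\eta\,\partial/\partial\xi+\bar\eta\,\partial/\partial\bar\xi$, so that a local holomorphic section is given by $\eta=w(\xi)$ with $w$ holomorphic. $\partial=\partial/\partial\xi$ and $\bar\partial=\partial/\partial\bar\xi$. A surface in $\mathbb{E}^3$ is minimal (a space-like surface in $\mathbb{E}^3_1$ is maximal) if its mean curvature vanishes. *)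

theory Defs
  imports "HOL-Complex_Analysis.Complex_Analysis"
begin

section \<open>Partial derivatives and Wirtinger operators\<close>

text \<open>Directional derivative of a function of the complex parameter; the coordinate
  partials with respect to the real and imaginary part of the parameter are the
  directions \<open>1\<close> and \<open>\<i>\<close>.\<close>

definition pd :: "complex \<Rightarrow> (complex \<Rightarrow> 'a::real_normed_vector) \<Rightarrow> complex \<Rightarrow> 'a" where
  "pd h f \<xi> = frechet_derivative f (at \<xi>) h"

definition wirt :: "(complex \<Rightarrow> complex) \<Rightarrow> complex \<Rightarrow> complex" where
  "wirt f \<xi> = (pd 1 f \<xi> - \<i> * pd \<i> f \<xi>) / 2"

definition wirt_bar :: "(complex \<Rightarrow> complex) \<Rightarrow> complex \<Rightarrow> complex" where
  "wirt_bar f \<xi> = (pd 1 f \<xi> + \<i> * pd \<i> f \<xi>) / 2"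

definition C2_on :: "complex set \<Rightarrow> (complex \<Rightarrow> 'a::real_normed_vector) \<Rightarrow> bool" where
  "C2_on U f \<longleftrightarrow> (\<forall>\<xi>\<in>U. f differentiable (at \<xi>)) \<and>
     (\<forall>h\<in>{1, \<i>}. \<forall>\<xi>\<in>U. pd h f differentiable (at \<xi>)) \<and>
     (\<forall>h\<in>{1, \<i>}. \<forall>k\<in>{1, \<i>}. continuous_on U (pd h (pd k f)))"


section \<open>Surfaces in Euclidean and Lorentzian 3-space\<close>

datatype ambient = Euclidean | Lorentzian

primrec eps :: "ambient \<Rightarrow> real" where
  "eps Euclidean = 1"
| "eps Lorentzian = - 1"

definition metric :: "ambient \<Rightarrow> real^3 \<Rightarrow> real^3 \<Rightarrow> real" where
  "metric a u v = u$1 * v$1 + u$2 * v$2 + eps a * (u$3 * v$3)"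

text \<open>The vector product adapted to the metric: it is characterised by
  \<open>metric a (metric_cross a u v) x = det (u, v, x)\<close>, hence is metric-orthogonal to
  both factors.\<close>

definition metric_cross :: "ambient \<Rightarrow> real^3 \<Rightarrow> real^3 \<Rightarrow> real^3" where
  "metric_cross a u v = vector [cross3 u v $ 1, cross3 u v $ 2, eps a * cross3 u v $ 3]"

definition immersed_at :: "(complex \<Rightarrow> real^3) \<Rightarrow> complex \<Rightarrow> bool" where
  "immersed_at X \<xi> \<longleftrightarrow> inj (frechet_derivative X (at \<xi>))"

definition spacelike_at :: "ambient \<Rightarrow> (complex \<Rightarrow> real^3) \<Rightarrow> complex \<Rightarrow> bool" where
  "spacelike_at a X \<xi> \<longleftrightarrow> (\<forall>h. h \<noteq> 0 \<longrightarrow> metric a (pd h X \<xi>) (pd h X \<xi>) > 0)"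

text \<open>On a space-like Lorentzian surface the normal is time-like, so the
  normalisation uses the absolute value of its square.\<close>

definition unit_normal :: "ambient \<Rightarrow> (complex \<Rightarrow> real^3) \<Rightarrow> complex \<Rightarrow> real^3" where
  "unit_normal a X \<xi> =
     (let n = metric_cross a (pd 1 X \<xi>) (pd \<i> X \<xi>)
      in (1 / sqrt \<bar>metric a n n\<bar>) *\<^sub>R n)"

definition first_form :: "ambient \<Rightarrow> (complex \<Rightarrow> real^3) \<Rightarrow> complex \<Rightarrow> complex \<Rightarrow> complex \<Rightarrow> real" where
  "first_form a X \<xi> h k = metric a (pd h X \<xi>) (pd k X \<xi>)"

definition second_form :: "ambient \<Rightarrow> (complex \<Rightarrow> real^3) \<Rightarrow> complex \<Rightarrow> complex \<Rightarrow> complex \<Rightarrow> real" where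
  "second_form a X \<xi> h k = metric a (pd h (pd k X) \<xi>) (unit_normal a X \<xi>)"

text \<open>Half the trace of the second fundamental form with respect to the first.\<close>

definition mean_curvature :: "ambient \<Rightarrow> (complex \<Rightarrow> real^3) \<Rightarrow> complex \<Rightarrow> real" where
  "mean_curvature a X \<xi> =
     (let E = first_form a X \<xi> 1 1; F = first_form a X \<xi> 1 \<i>; G = first_form a X \<xi> \<i> \<i>;
          L = second_form a X \<xi> 1 1; M = second_form a X \<xi> 1 \<i>; N = second_form a X \<xi> \<i> \<i>
      in (E * N - 2 * F * M + G * L) / (2 * (E * G - F\<^sup>2)))"

text \<open>A parametrized surface may have branch points; the geometric conditions are
  imposed at the points where the parametrization is an immersion.\<close>

definition minimal_surface :: "complex set \<Rightarrow> (complex \<Rightarrow> real^3) \<Rightarrow> bool" where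
  "minimal_surface U X \<longleftrightarrow> C2_on U X \<and>
     (\<forall>\<xi>\<in>U. immersed_at X \<xi> \<longrightarrow> mean_curvature Euclidean X \<xi> = 0)"

definition maximal_surface :: "complex set \<Rightarrow> (complex \<Rightarrow> real^3) \<Rightarrow> bool" where
  "maximal_surface U X \<longleftrightarrow> C2_on U X \<and>
     (\<forall>\<xi>\<in>U. immersed_at X \<xi> \<longrightarrow>
        spacelike_at Lorentzian X \<xi> \<and> mean_curvature Lorentzian X \<xi> = 0)"


section \<open>Local holomorphic sections and the surfaces they determine\<close>

text \<open>Range of the complex coordinate on the base: the sphere (minus a point) for
  \<open>Euclidean\<close>, the hyperbolic plane for \<open>Lorentzian\<close>.\<close>

primrec chart :: "ambient \<Rightarrow> complex set" where
  "chart Euclidean = UNIV"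
| "chart Lorentzian = ball 0 1"

text \<open>A pair \<open>(\<xi>, \<eta>)\<close> stands for the real tangent vector with holomorphic component
  \<open>\<eta>\<close> at the base point with coordinate \<open>\<xi>\<close>.\<close>

definition local_holomorphic_section ::
    "ambient \<Rightarrow> complex set \<Rightarrow> (complex \<Rightarrow> complex \<times> complex) \<Rightarrow> bool" where
  "local_holomorphic_section a U s \<longleftrightarrow> open U \<and> U \<subseteq> chart a \<and>
     (\<forall>\<xi>\<in>U. fst (s \<xi>) = \<xi>) \<and> (\<lambda>\<xi>. snd (s \<xi>)) holomorphic_on U"

definition surface_z :: "ambient \<Rightarrow> (complex \<Rightarrow> complex) \<Rightarrow> complex \<Rightarrow> complex" where
  "surface_z a w \<xi> =
     - of_real (eps a) * (1/2 * \<xi>\<^sup>2 * wirt (wirt w) \<xi> - \<xi> * wirt w \<xi> + w \<xi>)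
     + 1/2 * wirt_bar (wirt_bar (\<lambda>\<zeta>. cnj (w \<zeta>))) \<xi>"

definition surface_t :: "ambient \<Rightarrow> (complex \<Rightarrow> complex) \<Rightarrow> complex \<Rightarrow> complex" where
  "surface_t a w \<xi> =
     - of_real (eps a) *
       (1/2 * \<xi> * wirt (wirt w) \<xi> - 1/2 * wirt w \<xi>
        + 1/2 * cnj \<xi> * wirt_bar (wirt_bar (\<lambda>\<zeta>. cnj (w \<zeta>))) \<xi>
        - 1/2 * wirt_bar (\<lambda>\<zeta>. cnj (w \<zeta>)) \<xi>)"

text \<open>Here \<open>z = x\<^sup>1 + i x\<^sup>2\<close> and \<open>t = x\<^sup>3\<close>; that \<open>surface_t\<close> is real-valued wherever
  \<open>w\<close> is holomorphic is shown below.\<close>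

definition section_surface :: "ambient \<Rightarrow> (complex \<Rightarrow> complex) \<Rightarrow> complex \<Rightarrow> real^3" where
  "section_surface a w \<xi> =
     vector [Re (surface_z a w \<xi>), Im (surface_z a w \<xi>), Re (surface_t a w \<xi>)]"

lemma pd_eqI: "(f has_derivative f') (at \<xi>) \<Longrightarrow> pd h f \<xi> = f' h"
  unfolding pd_def using frechet_derivative_at by metis

lemma pd_cong_open:
  assumes "open U" "\<xi> \<in> U" "\<And>x. x \<in> U \<Longrightarrow> f x = g x"
  shows "pd h f \<xi> = pd h g \<xi>"
proof -
  have "(f has_derivative D) (at \<xi>) \<longleftrightarrow> (g has_derivative D) (at \<xi>)" for D
    using assms has_derivative_transform_within_open by metis
  then show ?thesis unfolding pd_def frechet_derivative_def by simp
qed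

lemma wirt_bar_cong_open:
  assumes "open U" "\<xi> \<in> U" "\<And>x. x \<in> U \<Longrightarrow> f x = g x"
  shows "wirt_bar f \<xi> = wirt_bar g \<xi>"
  unfolding wirt_bar_def using pd_cong_open[OF assms] by simp

lemma wirt_cong_open:
  assumes "open U" "\<xi> \<in> U" "\<And>x. x \<in> U \<Longrightarrow> f x = g x"
  shows "wirt f \<xi> = wirt g \<xi>"
  unfolding wirt_def using pd_cong_open[OF assms] by simp

lemma wirt_eq_deriv:
  assumes "(f has_field_derivative d) (at \<xi>)"
  shows "wirt f \<xi> = d" "wirt_bar (\<lambda>\<zeta>. cnj (f \<zeta>)) \<xi> = cnj d"
proof -
  have f: "(f has_derivative (\<lambda>h. d * h)) (at \<xi>)"
    using assms unfolding has_field_derivative_def .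
  have g: "((\<lambda>\<zeta>. cnj (f \<zeta>)) has_derivative (\<lambda>h. cnj (d * h))) (at \<xi>)"
    using bounded_linear.has_derivative[OF bounded_linear_cnj f] .
  show "wirt f \<xi> = d" "wirt_bar (\<lambda>\<zeta>. cnj (f \<zeta>)) \<xi> = cnj d"
    unfolding wirt_def wirt_bar_def pd_eqI[OF f] pd_eqI[OF g] by (simp_all add: algebra_simps)
qed

lemma surface_t_real:
  assumes U: "open U" "w holomorphic_on U" "\<xi> \<in> U"
  shows "surface_t a w \<xi> \<in> \<real>"
proof -
  have 1: "wirt w x = deriv w x" "wirt_bar (\<lambda>\<zeta>. cnj (w \<zeta>)) x = cnj (deriv w x)" if "x \<in> U" for x
    using wirt_eq_deriv[OF holomorphic_derivI[OF U(2,1) that]] by auto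
  have 2: "wirt (wirt w) \<xi> = deriv (deriv w) \<xi>"
    "wirt_bar (wirt_bar (\<lambda>\<zeta>. cnj (w \<zeta>))) \<xi> = cnj (deriv (deriv w) \<xi>)"
    using wirt_cong_open[OF U(1,3), of "wirt w" "deriv w"]
      wirt_bar_cong_open[OF U(1,3), of "wirt_bar (\<lambda>\<zeta>. cnj (w \<zeta>))" "\<lambda>\<zeta>. cnj (deriv w \<zeta>)"]
      wirt_eq_deriv[OF holomorphic_derivI[OF holomorphic_deriv[OF U(2,1)] U(1,3)]] 1 by auto
  have "cnj (surface_t a w \<xi>) = surface_t a w \<xi>"
    unfolding surface_t_def 2 1[OF U(3)] by simp
  then show ?thesis by (simp add: Reals_cnj_iff)
qed

end

theory Submission
  imports Defs
begin

text \<open>Weierstrass representation: on \<open>U\<close> the surface is the real part of a holomorphic curve \<open>F\<close>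
  whose derivative is, with \<open>\<epsilon> = \<plusminus>1\<close> the sign of the metric,
  \<open>\<partial>\<partial>\<partial>w \<cdot> ((1 - \<epsilon> \<xi>\<^sup>2) / 2, \<i> (1 + \<epsilon> \<xi>\<^sup>2) / 2, - \<epsilon> \<xi>)\<close>.
  This vector is null for the complexified metric, so the parametrization is conformal; its
  coordinates are harmonic, so the trace of the second fundamental form vanishes. The conformal
  factor is \<open>\<bar>\<partial>\<partial>\<partial>w\<bar>\<^sup>2 (1 + \<epsilon> \<bar>\<xi>\<bar>\<^sup>2)\<^sup>2 / 4\<close>, which for \<open>\<epsilon> = -1\<close> is positive on the
  unit disc away from the branch points \<open>\<partial>\<partial>\<partial>w = 0\<close>.\<close>

definition re_curve :: "(3 \<Rightarrow> complex \<Rightarrow> complex) \<Rightarrow> complex \<Rightarrow> real^3" where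
  "re_curve F \<xi> = (\<chi> i. Re (F i \<xi>))"

lemma re_curve_has_derivative:
  assumes "open U" "\<xi> \<in> U" "\<And>i. F i holomorphic_on U" "\<And>x. x \<in> U \<Longrightarrow> X x = re_curve F x"
  shows "(X has_derivative (\<lambda>h. re_curve (\<lambda>i x. h * deriv (F i) x) \<xi>)) (at \<xi>)"
proof -
  \<comment> \<open>Writing the vector as a finite sum over the standard basis reduces
    differentiation to the coordinates.\<close>
  have sum_axis: "(\<Sum>i\<in>UNIV. c i *\<^sub>R axis i (1::real)) = (\<chi> i. c i)" for c :: "3 \<Rightarrow> real"
    by (simp add: vec_eq_iff axis_def if_distrib cong: if_cong)
  have "((\<lambda>x. \<Sum>i\<in>UNIV. Re (F i x) *\<^sub>R axis i (1::real)) has_derivative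
      (\<lambda>h. \<Sum>i\<in>UNIV. Re (deriv (F i) \<xi> * h) *\<^sub>R axis i 1)) (at \<xi>)"
    using holomorphic_derivI[OF assms(3,1,2)]
    by (intro has_derivative_sum has_derivative_scaleR_left has_derivative_Re)
      (simp add: has_field_derivative_def)
  then have "(re_curve F has_derivative (\<lambda>h. re_curve (\<lambda>i x. h * deriv (F i) x) \<xi>)) (at \<xi>)"
    unfolding re_curve_def
    unfolding sum_axis by (simp add: mult.commute)
  then show ?thesis
    using has_derivative_transform_within_open[OF _ assms(1,2)] assms(4) by metis
qed

text \<open>\<open>X\<close> is tied to \<open>F\<close> only on \<open>U\<close>: the Wirtinger
  operators in the surface formula become \<open>deriv\<close> where \<open>w\<close> is
  holomorphic.\<close>

locale re_holomorphic_curve =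
  fixes U :: "complex set" and F :: "3 \<Rightarrow> complex \<Rightarrow> complex" and X :: "complex \<Rightarrow> real^3"
  assumes U: "open U"
    and F: "\<And>i. F i holomorphic_on U"
    and X: "\<And>x. x \<in> U \<Longrightarrow> X x = re_curve F x"
begin

lemma pd_re_curve:
  "\<xi> \<in> U \<Longrightarrow> pd h X \<xi> = re_curve (\<lambda>i x. h * deriv (F i) x) \<xi>"
  using pd_eqI[OF re_curve_has_derivative[OF U _ F X]] by simp

text \<open>On \<open>U\<close> the partial \<open>pd k X\<close> is again the real part of a
  holomorphic curve, \<open>k\<close> times the derivative of \<open>F\<close>, so the first-order
  result applies a second time.\<close>

lemma pd_re_curve_has_derivative:
  assumes "\<xi> \<in> U"
  shows "(pd k X has_derivative (\<lambda>h. re_curve (\<lambda>i x. h * (k * deriv (deriv (F i)) x)) \<xi>)) (at \<xi>)"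
proof -
  have "(\<lambda>x. k * deriv (F i) x) holomorphic_on U" for i
    by (intro holomorphic_intros holomorphic_deriv F U)
  from re_curve_has_derivative[OF U assms this pd_re_curve]
  have "(pd k X has_derivative (\<lambda>h. re_curve (\<lambda>i x. h * deriv (\<lambda>x. k * deriv (F i) x) x) \<xi>)) (at \<xi>)"
    by simp
  moreover have "deriv (\<lambda>x. k * deriv (F i) x) \<xi> = k * deriv (deriv (F i)) \<xi>" for i
    using holomorphic_deriv[OF F U] U assms
    by (intro deriv_cmult) (auto simp: holomorphic_on_open field_differentiable_def)
  ultimately show ?thesis
    by (simp add: re_curve_def)
qed

lemma pd_pd_re_curve:
  "\<xi> \<in> U \<Longrightarrow> pd h (pd k X) \<xi> = re_curve (\<lambda>i x. h * (k * deriv (deriv (F i)) x)) \<xi>"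
  using pd_eqI[OF pd_re_curve_has_derivative] .

lemma C2_on_re_curve: "C2_on U X"
proof -
  have "continuous_on U (pd h (pd k X))" for h k
  proof -
    have "continuous_on U (\<lambda>x. re_curve (\<lambda>i x. h * (k * deriv (deriv (F i)) x)) x)"
      unfolding re_curve_def
      by (intro continuous_intros holomorphic_on_imp_continuous_on holomorphic_deriv F U)
    then show ?thesis
      by (simp add: pd_pd_re_curve cong: continuous_on_cong)
  qed
  then show ?thesis
    unfolding C2_on_def
    using re_curve_has_derivative[OF U _ F X] pd_re_curve_has_derivative
    by (blast intro: differentiableI)
qed

context
  fixes a :: ambient and \<xi> :: complex
  assumes \<xi>: "\<xi> \<in> U"
    and null: "(deriv (F 1) \<xi>)\<^sup>2 + (deriv (F 2) \<xi>)\<^sup>2 + of_real (eps a) * (deriv (F 3) \<xi>)\<^sup>2 = 0"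
begin

text \<open>Conformality: \<open>polar\<close> splits each product into a multiple of the real part
  of \<open>h * k * c\<^sup>2\<close>, whose weighted sum vanishes by nullity, and a multiple of the
  squared modulus of \<open>c\<close>.\<close>

lemma metric_pd_null_curve:
  "metric a (pd h X \<xi>) (pd k X \<xi>) = Re (h * cnj k) / 2 *
    ((cmod (deriv (F 1) \<xi>))\<^sup>2 + (cmod (deriv (F 2) \<xi>))\<^sup>2 + eps a * (cmod (deriv (F 3) \<xi>))\<^sup>2)"
proof -
  have polar: "Re (h * c) * Re (k * c) = (Re (h * k * c\<^sup>2) + Re (h * cnj k) * (cmod c)\<^sup>2) / 2" for c
    unfolding cmod_power2 by (simp add: power2_eq_square algebra_simps)
  have "Re (h * k * (deriv (F 1) \<xi>)\<^sup>2) + Re (h * k * (deriv (F 2) \<xi>)\<^sup>2)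
      + eps a * Re (h * k * (deriv (F 3) \<xi>)\<^sup>2)
    = Re (h * k * ((deriv (F 1) \<xi>)\<^sup>2 + (deriv (F 2) \<xi>)\<^sup>2 + of_real (eps a) * (deriv (F 3) \<xi>)\<^sup>2))"
    by (simp add: algebra_simps)
  also have "\<dots> = 0"
    using null by simp
  finally show ?thesis
    unfolding metric_def pd_re_curve[OF \<xi>] re_curve_def vec_lambda_beta polar
    by (simp add: field_simps)
qed

text \<open>Conformality (F = 0, G = E) and harmonicity (N = -L) make the numerator zero; at branch
  points the quotient is then 0 / 0 = 0.\<close>

lemma mean_curvature_null_curve: "mean_curvature a X \<xi> = 0"
proof -
  have "first_form a X \<xi> 1 \<i> = 0" "first_form a X \<xi> \<i> \<i> = first_form a X \<xi> 1 1"
    unfolding first_form_def metric_pd_null_curve by simp_all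
  moreover have "pd \<i> (pd \<i> X) \<xi> = - pd 1 (pd 1 X) \<xi>"
    unfolding pd_pd_re_curve[OF \<xi>] re_curve_def by (simp add: vec_eq_iff)
  then have "second_form a X \<xi> \<i> \<i> = - second_form a X \<xi> 1 1"
    unfolding second_form_def metric_def by simp
  ultimately show ?thesis
    unfolding mean_curvature_def Let_def by simp
qed

end

end

text \<open>Only real parts matter, so antiholomorphic terms are replaced by their conjugates, with
  z multiplied by -\<i> first for its imaginary part; in t each term meets its conjugate, which
  absorbs the factor 1/2.\<close>

definition weierstrass_curve :: "ambient \<Rightarrow> (complex \<Rightarrow> complex) \<Rightarrow> 3 \<Rightarrow> complex \<Rightarrow> complex" where
  "weierstrass_curve a w i \<xi> =
     (let e = of_real (eps a);
          f = 1/2 * \<xi>\<^sup>2 * deriv (deriv w) \<xi> - \<xi> * deriv w \<xi> + w \<xi>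
      in if i = 1 then - e * f + deriv (deriv w) \<xi> / 2
         else if i = 2 then \<i> * (e * f + deriv (deriv w) \<xi> / 2)
         else - e * (\<xi> * deriv (deriv w) \<xi> - deriv w \<xi>))"

context
  fixes U :: "complex set" and w :: "complex \<Rightarrow> complex"
  assumes U: "open U" and w: "w holomorphic_on U"
begin

lemma section_surface_eq_re_curve:
  assumes "\<xi> \<in> U"
  shows "section_surface a w \<xi> = re_curve (weierstrass_curve a w) \<xi>"
proof -
  have 1: "wirt w x = deriv w x" "wirt_bar (\<lambda>\<zeta>. cnj (w \<zeta>)) x = cnj (deriv w x)" if "x \<in> U" for x
    using wirt_eq_deriv[OF holomorphic_derivI[OF w U that]] by auto
  \<comment> \<open>The inner operators are identified on all of the open set \<open>U\<close>,
    which suffices to differentiate once more at \<xi>.\<close>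
  have 2: "wirt (wirt w) \<xi> = deriv (deriv w) \<xi>"
    "wirt_bar (wirt_bar (\<lambda>\<zeta>. cnj (w \<zeta>))) \<xi> = cnj (deriv (deriv w) \<xi>)"
    using wirt_cong_open[OF U assms, of "wirt w" "deriv w"]
      wirt_bar_cong_open[OF U assms, of "wirt_bar (\<lambda>\<zeta>. cnj (w \<zeta>))" "\<lambda>\<zeta>. cnj (deriv w \<zeta>)"]
      wirt_eq_deriv[OF holomorphic_derivI[OF holomorphic_deriv[OF w U] U assms]] 1 by auto
  show ?thesis
    unfolding section_surface_def surface_z_def surface_t_def 2 1[OF assms]
    by (simp add: vec_eq_iff forall_3 re_curve_def weierstrass_curve_def Let_def field_simps)
qed

lemma holomorphic_weierstrass_curve: "weierstrass_curve a w i holomorphic_on U"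
proof -
  have "(\<lambda>\<xi>. weierstrass_curve a w i \<xi>) holomorphic_on U"
    unfolding weierstrass_curve_def Let_def
    by (cases "i = 1"; cases "i = 2"; simp; intro holomorphic_intros holomorphic_deriv U w; simp)
  then show ?thesis by simp
qed

text \<open>Lower-order terms cancel: \<open>f\<close> has derivative
  \<open>\<xi>\<^sup>2 * \<phi> / 2\<close>, and
  \<open>\<xi> * deriv (deriv w) \<xi> - deriv w \<xi>\<close> has derivative
  \<open>\<xi> * \<phi>\<close>.\<close>

lemma deriv_weierstrass_curve:
  assumes "\<xi> \<in> U"
  defines "\<phi> \<equiv> deriv (deriv (deriv w)) \<xi>"
  shows "deriv (weierstrass_curve a w 1) \<xi> = (1 - of_real (eps a) * \<xi>\<^sup>2) / 2 * \<phi>"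
    and "deriv (weierstrass_curve a w 2) \<xi> = \<i> * (1 + of_real (eps a) * \<xi>\<^sup>2) / 2 * \<phi>"
    and "deriv (weierstrass_curve a w 3) \<xi> = - of_real (eps a) * \<xi> * \<phi>"
proof -
  note w' = holomorphic_deriv[OF w U]
  note [derivative_intros] = holomorphic_derivI[OF w U assms(1)] holomorphic_derivI[OF w' U assms(1)]
    holomorphic_derivI[OF holomorphic_deriv[OF w' U] U assms(1)]
  have "(weierstrass_curve a w 1 has_field_derivative (1 - of_real (eps a) * \<xi>\<^sup>2) / 2 * \<phi>) (at \<xi>)"
    unfolding weierstrass_curve_def[abs_def] Let_def \<phi>_def
    by (auto intro!: derivative_eq_intros simp: field_simps power2_eq_square)
  then show "deriv (weierstrass_curve a w 1) \<xi> = (1 - of_real (eps a) * \<xi>\<^sup>2) / 2 * \<phi>"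
    by (rule DERIV_imp_deriv)
  have "(weierstrass_curve a w 2 has_field_derivative \<i> * (1 + of_real (eps a) * \<xi>\<^sup>2) / 2 * \<phi>) (at \<xi>)"
    unfolding weierstrass_curve_def[abs_def] Let_def \<phi>_def
    by (auto intro!: derivative_eq_intros simp: field_simps power2_eq_square)
  then show "deriv (weierstrass_curve a w 2) \<xi> = \<i> * (1 + of_real (eps a) * \<xi>\<^sup>2) / 2 * \<phi>"
    by (rule DERIV_imp_deriv)
  have "(weierstrass_curve a w 3 has_field_derivative - of_real (eps a) * \<xi> * \<phi>) (at \<xi>)"
    unfolding weierstrass_curve_def[abs_def] Let_def \<phi>_def
    by (auto intro!: derivative_eq_intros simp: field_simps power2_eq_square)
  then show "deriv (weierstrass_curve a w 3) \<xi> = - of_real (eps a) * \<xi> * \<phi>"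
    by (rule DERIV_imp_deriv)
qed

text \<open>With \<epsilon> = \<open>eps a\<close>, the first two squares add up to
  \<open>- \<epsilon> * \<xi>\<^sup>2 * \<phi>\<^sup>2\<close>; the third term cancels this because
  \<epsilon> cubed equals \<epsilon>.\<close>

lemma weierstrass_curve_null:
  assumes "\<xi> \<in> U"
  shows "(deriv (weierstrass_curve a w 1) \<xi>)\<^sup>2 + (deriv (weierstrass_curve a w 2) \<xi>)\<^sup>2
    + of_real (eps a) * (deriv (weierstrass_curve a w 3) \<xi>)\<^sup>2 = 0"
  unfolding deriv_weierstrass_curve[OF assms]
  by (cases a) (simp_all add: power2_eq_square field_simps)

interpretation re_holomorphic_curve U "weierstrass_curve a w" "section_surface a w" for a
  by unfold_locales (auto simp: U holomorphic_weierstrass_curve section_surface_eq_re_curve)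

lemma C2_on_section_surface: "C2_on U (section_surface a w)"
  by (rule C2_on_re_curve)

lemma mean_curvature_section_surface:
  "\<xi> \<in> U \<Longrightarrow> mean_curvature a (section_surface a w) \<xi> = 0"
  by (rule mean_curvature_null_curve[OF _ weierstrass_curve_null])

lemma metric_section_surface:
  assumes "\<xi> \<in> U"
  shows "metric a (pd h (section_surface a w) \<xi>) (pd h (section_surface a w) \<xi>) =
    (cmod h * cmod (deriv (deriv (deriv w)) \<xi>) * (1 + eps a * (cmod \<xi>)\<^sup>2) / 2)\<^sup>2"
proof -
  \<comment> \<open>Parallelogram law for 1 and \<open>eps a * \<xi>\<^sup>2\<close>, completed to a
    square.\<close>
  have "(cmod (1 - of_real (eps a) * \<xi>\<^sup>2))\<^sup>2 + (cmod (1 + of_real (eps a) * \<xi>\<^sup>2))\<^sup>2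
      + 4 * eps a * (cmod \<xi>)\<^sup>2 = 2 * (1 + eps a * (cmod \<xi>)\<^sup>2)\<^sup>2"
    unfolding cmod_power2 by (cases a) (simp_all add: power2_eq_square algebra_simps)
  then have key: "(cmod (1 - of_real (eps a) * \<xi>\<^sup>2))\<^sup>2 =
      2 * (1 + eps a * (cmod \<xi>)\<^sup>2)\<^sup>2 - (cmod (1 + of_real (eps a) * \<xi>\<^sup>2))\<^sup>2 - 4 * eps a * (cmod \<xi>)\<^sup>2"
    by linarith
  have "(eps a)\<^sup>2 = 1"
    by (cases a) simp_all
  moreover have "Re (h * cnj h) = (cmod h)\<^sup>2"
    unfolding cmod_power2 by (simp add: power2_eq_square)
  ultimately show ?thesis
    unfolding metric_pd_null_curve[OF assms weierstrass_curve_null[OF assms]]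
      deriv_weierstrass_curve[OF assms] norm_mult norm_divide power_mult_distrib power_divide key
    by (simp add: field_simps)
qed

lemma section_surface_immersed_imp:
  assumes "\<xi> \<in> U" "immersed_at (section_surface a w) \<xi>"
  shows "deriv (deriv (deriv w)) \<xi> \<noteq> 0"
proof
  assume "deriv (deriv (deriv w)) \<xi> = 0"
  then have "deriv (weierstrass_curve a w i) \<xi> = 0" for i
    using deriv_weierstrass_curve[OF assms(1), of a] exhaust_3[of i] by auto
  \<comment> \<open>The differential vanishes, so it identifies the directions 1 and 0 and is not
    injective.\<close>
  then have "pd 1 (section_surface a w) \<xi> = pd 0 (section_surface a w) \<xi>"
    unfolding pd_re_curve[OF assms(1)] re_curve_def by simp
  then show False
    using assms(2) unfolding immersed_at_def pd_def by (auto dest: injD)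
qed

text \<open>The squared length is a perfect square, so it is positive once its factors are nonzero:
  the third derivative of \<open>w\<close> by immersion, \<open>1 - (cmod \<xi>)\<^sup>2\<close>
  inside the disc.\<close>

lemma spacelike_section_surface:
  assumes "\<xi> \<in> U" "cmod \<xi> < 1" "immersed_at (section_surface Lorentzian w) \<xi>"
  shows "spacelike_at Lorentzian (section_surface Lorentzian w) \<xi>"
proof -
  have "(cmod \<xi>)\<^sup>2 < 1"
    using assms(2) by (simp add: power_less_one_iff abs_square_less_1)
  then show ?thesis
    unfolding spacelike_at_def metric_section_surface[OF assms(1)]
    using section_surface_immersed_imp[OF assms(1,3)] by simp
qed

end

theorem theorem6:
  fixes U :: "complex set" and w :: "complex \<Rightarrow> complex"
  shows "(local_holomorphic_section Euclidean U (\<lambda>\<xi>. (\<xi>, w \<xi>)) \<longrightarrow>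
            minimal_surface U (section_surface Euclidean w)) \<and>
         (local_holomorphic_section Lorentzian U (\<lambda>\<xi>. (\<xi>, w \<xi>)) \<longrightarrow>
            maximal_surface U (section_surface Lorentzian w))"
  unfolding local_holomorphic_section_def minimal_surface_def maximal_surface_def
  using C2_on_section_surface mean_curvature_section_surface spacelike_section_surface
  by (auto simp: subset_iff)

end
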